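(* There is a unique operator $\mathcal{D}^{\alpha,\beta}$ of the form $\mathcal{D}^{\alpha,\beta}=M({}_aD_t^{\alpha},{}_tD_b^{\beta})$, with $M:\mathbb{R}^2\to\mathbb{C}$ a mapping independent of $(\alpha,\beta)$, satisfying the following conditions: (i) (gluing) for $m\in\mathbb{N}^*$ and $x\in C^m$ real valued, $\mathcal{D}^{m,m}x=\frac{d^mx}{dt^m}$; (ii) $M$ is $\mathbb{R}$-linear; (iii) (reconstruction) $M$ is invertible; (iv) if $x\in C^0$ is real valued with one-sided derivatives $\frac{d_+x}{dt}$ and $\frac{d_-x}{dt}$ at $t$ satisfying $\frac{d_+x}{dt}=-\frac{d_-x}{dt}$, then $\mathcal{D}^{1,1}x(t)=i\frac{d_+x}{dt}$. It is given by $$\mathcal{D}^{\alpha,\beta}=\frac12\left[{}_aD_t^{\alpha}-{}_tD_b^{\beta}\right]+\frac{i}{2}\left[{}_aD_t^{\alpha}+{}_tD_b^{\beta}\right].$$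
   Context: ${}_aD_t^{\alpha}$ and ${}_tD_b^{\beta}$ denote the left and right Riemann-Liouville derivatives on $(a,b)$. The identity $\mathcal{D}^{\alpha,\beta}=M({}_aD_t^{\alpha},{}_tD_b^{\beta})$ means $\mathcal{D}^{\alpha,\beta}x(t)=M({}_aD_t^{\alpha}x(t),{}_tD_b^{\beta}x(t))$ for real valued $x$. Conventions of the paper at integer order: for $m\in\mathbb{N}^*$ and $x\in C^m$, ${}_aD_t^{m}x=\frac{d^mx}{dt^m}$ and ${}_tD_b^{m}x=-\frac{d^mx}{dt^m}$. For $x\in C^0$ having one-sided derivatives $\frac{d_+x}{dt}$, $\frac{d_-x}{dt}$ at $t$, the order $1$ derivatives at $t$ are ${}_aD_t^{1}x=\frac{d_+x}{dt}$ and ${}_tD_b^{1}x=-\frac{d_-x}{dt}$. *)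

theory Defs
  imports "HOL-Analysis.Analysis"
begin

definition C_class_on :: "nat \<Rightarrow> (real \<Rightarrow> real) \<Rightarrow> real set \<Rightarrow> bool" where
  "C_class_on m x S \<longleftrightarrow>
     (\<forall>k<m. (deriv ^^ k) x differentiable_on S) \<and> (\<forall>k\<le>m. continuous_on S ((deriv ^^ k) x))"

text \<open>
  Fractional integrals of order \<open>\<mu> > 0\<close>, with \<open>\<mu> = n - \<alpha>\<close> below:
  \<open>1 / \<Gamma>(\<mu>)\<close> times the integral of the kernel \<open>\<bar>t - s\<bar> powr (\<mu> - 1)\<close> against \<open>x\<close>.
\<close>

definition left_RL_integral :: "real \<Rightarrow> real \<Rightarrow> (real \<Rightarrow> real) \<Rightarrow> real \<Rightarrow> real" where
  "left_RL_integral a \<mu> x t =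
     1 / Gamma \<mu> * (LINT s:{a..t}|lebesgue. (t - s) powr (\<mu> - 1) * x s)"

definition right_RL_integral :: "real \<Rightarrow> real \<Rightarrow> (real \<Rightarrow> real) \<Rightarrow> real \<Rightarrow> real" where
  "right_RL_integral b \<mu> x t =
     1 / Gamma \<mu> * (LINT s:{t..b}|lebesgue. (s - t) powr (\<mu> - 1) * x s)"

text \<open>
  \<open>f\<close> is \<open>n\<close> times differentiable at \<open>t\<close>: its derivatives of order below \<open>n\<close> exist near \<open>t\<close>,
  and the one of order \<open>n\<close> exists at \<open>t\<close> and equals \<open>d\<close>.
\<close>

definition has_nth_deriv :: "nat \<Rightarrow> (real \<Rightarrow> real) \<Rightarrow> real \<Rightarrow> real \<Rightarrow> bool" where
  "has_nth_deriv n f t d \<longleftrightarrow>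
     n > 0 \<and>
     (\<forall>k<n - 1. eventually (\<lambda>u. (deriv ^^ k) f differentiable (at u)) (nhds t)) \<and>
     ((deriv ^^ (n - 1)) f has_real_derivative d) (at t)"

text \<open>
  \<open>left_RL_deriv a b \<alpha> x t d\<close> says that the left Riemann-Liouville derivative of order \<open>\<alpha>\<close> of
  \<open>x\<close> on \<open>(a,b)\<close> exists at \<open>t\<close> and equals \<open>d\<close>; similarly for the right derivative. At orders
  that are not integers this is the Riemann-Liouville formula with \<open>n = \<lfloor>\<alpha>\<rfloor> + 1\<close>. At integer
  orders the value is fixed by convention; note that the right derivative of order \<open>m\<close> is
  \<open>- d\<^sup>mx/dt\<^sup>m\<close> for every \<open>m\<close>, whereas the formula would give \<open>(-1)\<^sup>m d\<^sup>mx/dt\<^sup>m\<close>.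
\<close>

inductive left_RL_deriv ::
  "real \<Rightarrow> real \<Rightarrow> real \<Rightarrow> (real \<Rightarrow> real) \<Rightarrow> real \<Rightarrow> real \<Rightarrow> bool" for a b :: real where
  left_fractional:
    "left_RL_deriv a b \<alpha> x t d"
    if "\<alpha> > 0" "\<alpha> \<notin> \<int>" "t \<in> {a<..<b}" "n = nat \<lfloor>\<alpha>\<rfloor> + 1"
       "eventually (\<lambda>u. (\<lambda>s. (u - s) powr (real n - \<alpha> - 1) * x s)
          absolutely_integrable_on {a..u}) (nhds t)"
       "has_nth_deriv n (left_RL_integral a (real n - \<alpha>) x) t d"
| left_integer:
    "left_RL_deriv a b (real m) x t ((deriv ^^ m) x t)"
    if "m \<ge> 1" "t \<in> {a<..<b}" "C_class_on m x {a<..<b}"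
| left_one:
    "left_RL_deriv a b 1 x t dp"
    if "t \<in> {a<..<b}" "continuous_on {a<..<b} x"
       "(x has_real_derivative dp) (at_right t)" "(x has_real_derivative dm) (at_left t)"

inductive right_RL_deriv ::
  "real \<Rightarrow> real \<Rightarrow> real \<Rightarrow> (real \<Rightarrow> real) \<Rightarrow> real \<Rightarrow> real \<Rightarrow> bool" for a b :: real where
  right_fractional:
    "right_RL_deriv a b \<beta> x t ((- 1) ^ n * d)"
    if "\<beta> > 0" "\<beta> \<notin> \<int>" "t \<in> {a<..<b}" "n = nat \<lfloor>\<beta>\<rfloor> + 1"
       "eventually (\<lambda>u. (\<lambda>s. (s - u) powr (real n - \<beta> - 1) * x s)
          absolutely_integrable_on {u..b}) (nhds t)"
       "has_nth_deriv n (right_RL_integral b (real n - \<beta>) x) t d"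
| right_integer:
    "right_RL_deriv a b (real m) x t (- (deriv ^^ m) x t)"
    if "m \<ge> 1" "t \<in> {a<..<b}" "C_class_on m x {a<..<b}"
| right_one:
    "right_RL_deriv a b 1 x t (- dm)"
    if "t \<in> {a<..<b}" "continuous_on {a<..<b} x"
       "(x has_real_derivative dp) (at_right t)" "(x has_real_derivative dm) (at_left t)"

text \<open>
  An operator maps the orders \<open>\<alpha>\<close>, \<open>\<beta>\<close>, a function \<open>x\<close> and a point \<open>t\<close> to a value.
\<close>

type_synonym frac_op = "real \<Rightarrow> real \<Rightarrow> (real \<Rightarrow> real) \<Rightarrow> real \<Rightarrow> complex"

text \<open>
  The identity \<open>D = M(left, right)\<close>. An operator is partial: where one of the two derivatives
  does not exist it takes the value \<open>undefined\<close>, as for \<^const>\<open>extensional\<close> functions, so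
  that equality of operators is equality on their common domain.
\<close>

definition op_of_form :: "real \<Rightarrow> real \<Rightarrow> (real \<times> real \<Rightarrow> complex) \<Rightarrow> frac_op \<Rightarrow> bool" where
  "op_of_form a b M D \<longleftrightarrow>
     (\<forall>\<alpha> \<beta> x t.
        (\<forall>l r. left_RL_deriv a b \<alpha> x t l \<and> right_RL_deriv a b \<beta> x t r \<longrightarrow> D \<alpha> \<beta> x t = M (l, r)) \<and>
        ((\<nexists>l r. left_RL_deriv a b \<alpha> x t l \<and> right_RL_deriv a b \<beta> x t r) \<longrightarrow> D \<alpha> \<beta> x t = undefined))"

definition gluing :: "real \<Rightarrow> real \<Rightarrow> frac_op \<Rightarrow> bool" where
  "gluing a b D \<longleftrightarrow>
     (\<forall>m\<ge>1. \<forall>x. C_class_on m x {a<..<b} \<longrightarrow>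
        (\<forall>t\<in>{a<..<b}. D (real m) (real m) x t = of_real ((deriv ^^ m) x t)))"

definition antisymmetric_condition :: "real \<Rightarrow> real \<Rightarrow> frac_op \<Rightarrow> bool" where
  "antisymmetric_condition a b D \<longleftrightarrow>
     (\<forall>x. \<forall>t\<in>{a<..<b}. \<forall>dp dm.
        continuous_on {a<..<b} x \<and>
        (x has_real_derivative dp) (at_right t) \<and> (x has_real_derivative dm) (at_left t) \<and>
        dp = - dm \<longrightarrow> D 1 1 x t = \<i> * of_real dp)"

definition admissible_op :: "real \<Rightarrow> real \<Rightarrow> frac_op \<Rightarrow> bool" where
  "admissible_op a b D \<longleftrightarrow>
     (\<exists>M. op_of_form a b M D \<and> gluing a b D \<and> linear M \<and> bij M \<and> antisymmetric_condition a b D)"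

end

theory Submission
  imports Defs
begin

text \<open>
  A linear map \<open>M\<close> on \<open>\<real>\<^sup>2\<close> is determined by its values on the basis \<open>(1, - 1)\<close>, \<open>(1, 1)\<close>,
  and the two conditions on the operator prescribe exactly these values. At order \<open>1\<close> the function
  \<open>x s = s\<close> has the pair of derivatives \<open>(1, - 1)\<close>, which gluing sends to \<open>1\<close>, while
  \<open>x s = \<bar>s - t\<bar>\<close> has at its corner \<open>t\<close> the pair \<open>(1, 1)\<close>, which the antisymmetric condition
  sends to \<open>\<i>\<close>. Hence \<open>M\<close> is the map \<open>(l, r) \<mapsto> (l - r) / 2 + \<i> (l + r) / 2\<close>
  (\<open>linear_mapping_eqI\<close>, \<open>admissible_mapping_eq\<close>). Conversely this map is linear and bijective.
  It gives an operator satisfying the gluing condition, because the pair of order \<open>m\<close> derivatives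
  of a \<open>C\<^sup>m\<close> function lies on the line spanned by \<open>(1, - 1)\<close>, and the antisymmetric condition,
  whose hypothesis says that the pair lies on the line spanned by \<open>(1, 1)\<close>.

  What remains is that a mapping \<open>M\<close> defines one and only one operator. As the Riemann-Liouville
  derivatives are relations between a function, a point and a value, this needs that they are
  single-valued (\<open>left_RL_deriv_unique\<close>, \<open>right_RL_deriv_unique\<close>); the point at issue is order
  \<open>1\<close>, where the convention for \<open>C\<^sup>1\<close> functions and the one for continuous functions with
  one-sided derivatives both apply, and agree.
\<close>

section \<open>The derivatives are single-valued\<close>

lemma has_real_derivative_unique_within:
  fixes f :: "real \<Rightarrow> real"
  assumes "(f has_real_derivative d) (at t within S)" "(f has_real_derivative d') (at t within S)"
    and "at t within S \<noteq> bot"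
  shows "d = d'"
  using assms unfolding has_field_derivative_iff by (blast intro: tendsto_unique)

lemma has_nth_deriv_unique:
  assumes "has_nth_deriv n f t d" "has_nth_deriv n f t d'"
  shows "d = d'"
  using assms unfolding has_nth_deriv_def by (blast intro: DERIV_unique)

lemma C_class_on_1_has_real_derivative:
  assumes "C_class_on 1 x S" "open S" "t \<in> S"
  shows "(x has_real_derivative deriv x t) (at t within T)"
proof -
  have "x differentiable_on S"
    using assms(1) by (auto simp: C_class_on_def)
  then have "x differentiable (at t)"
    using assms(2,3) by (simp add: differentiable_on_eq_differentiable_at)
  then have "(x has_real_derivative deriv x t) (at t)"
    by (simp add: DERIV_deriv_iff_real_differentiable)
  then show ?thesis
    by (rule has_field_derivative_at_within)
qed

text \<open>
  The fractional clause excludes integer orders, so two different clauses can meet only at order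
  \<open>1\<close>, where the derivative of a \<open>C\<^sup>1\<close> function is also its one-sided derivative.
\<close>

lemma left_RL_deriv_unique:
  assumes "left_RL_deriv a b \<alpha> x t l" "left_RL_deriv a b \<alpha> x t l'"
  shows "l = l'"
proof -
  have glue: "(deriv ^^ m) x t = dp"
    if "real m = 1" "C_class_on m x {a<..<b}" "t \<in> {a<..<b}"
      "(x has_real_derivative dp) (at_right t)" for m dp
  proof -
    have "m = 1" using that(1) by simp
    with that show ?thesis
      using C_class_on_1_has_real_derivative[of x "{a<..<b}" t "{t<..}"]
        has_real_derivative_unique_within[of x "deriv x t" t "{t<..}" dp] by auto
  qed
  show ?thesis
    using assms(1)
  proof cases
    case left_fractional
    note 1 = this
    from assms(2) show ?thesis
      by cases (use 1 has_nth_deriv_unique in auto)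
  next
    case (left_integer m)
    note 1 = this
    from assms(2) show ?thesis
      by cases (use 1 glue in auto)
  next
    case left_one
    note 1 = this
    from assms(2) show ?thesis
    proof cases
      case left_one
      then show ?thesis
        using 1 has_real_derivative_unique_within[of x l t "{t<..}" l'] by auto
    qed (use 1 glue in auto)
  qed
qed

lemma right_RL_deriv_unique:
  assumes "right_RL_deriv a b \<beta> x t r" "right_RL_deriv a b \<beta> x t r'"
  shows "r = r'"
proof -
  have glue: "(deriv ^^ m) x t = dm"
    if "real m = 1" "C_class_on m x {a<..<b}" "t \<in> {a<..<b}"
      "(x has_real_derivative dm) (at_left t)" for m dm
  proof -
    have "m = 1" using that(1) by simp
    with that show ?thesis
      using C_class_on_1_has_real_derivative[of x "{a<..<b}" t "{..<t}"]
        has_real_derivative_unique_within[of x "deriv x t" t "{..<t}" dm] by auto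
  qed
  show ?thesis
    using assms(1)
  proof cases
    case right_fractional
    note 1 = this
    from assms(2) show ?thesis
      by cases (use 1 has_nth_deriv_unique in auto)
  next
    case (right_integer m)
    note 1 = this
    from assms(2) show ?thesis
      by cases (use 1 glue in auto)
  next
    case (right_one dp dm)
    note 1 = this
    from assms(2) show ?thesis
    proof cases
      case (right_one dp' dm')
      then show ?thesis
        using 1 has_real_derivative_unique_within[of x dm t "{..<t}" dm'] by auto
    qed (use 1 glue in auto)
  qed
qed

lemma op_of_form_apply:
  assumes "op_of_form a b M D" "left_RL_deriv a b \<alpha> x t l" "right_RL_deriv a b \<beta> x t r"
  shows "D \<alpha> \<beta> x t = M (l, r)"
  using assms(1)[unfolded op_of_form_def, rule_format, of \<alpha> x t \<beta>] assms(2,3) by auto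

lemma op_of_form_unique:
  assumes "op_of_form a b M D" "op_of_form a b M D'"
  shows "D = D'"
proof (intro ext)
  fix \<alpha> \<beta> x t
  show "D \<alpha> \<beta> x t = D' \<alpha> \<beta> x t"
  proof (cases "\<exists>l r. left_RL_deriv a b \<alpha> x t l \<and> right_RL_deriv a b \<beta> x t r")
    case True
    then show ?thesis using assms unfolding op_of_form_def by metis
  next
    case False
    then show ?thesis using assms unfolding op_of_form_def by metis
  qed
qed

text \<open>
  Single-valuedness of the two derivatives enters here: without it two pairs \<open>(l, r)\<close> could ask
  for different values of \<open>D\<close> at the same arguments.
\<close>

lemma op_of_form_exists: "\<exists>D. op_of_form a b M D"
proof -
  let ?P = "\<lambda>\<alpha> \<beta> x t p. left_RL_deriv a b \<alpha> x t (fst p) \<and> right_RL_deriv a b \<beta> x t (snd p)"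
  define D where "D \<alpha> \<beta> x t =
    (if \<exists>p. ?P \<alpha> \<beta> x t p then M (SOME p. ?P \<alpha> \<beta> x t p) else undefined)" for \<alpha> \<beta> x t
  have "D \<alpha> \<beta> x t = M (l, r)"
    if "left_RL_deriv a b \<alpha> x t l" "right_RL_deriv a b \<beta> x t r" for \<alpha> \<beta> x t l r
  proof -
    have *: "?P \<alpha> \<beta> x t (l, r)" using that by simp
    then have "?P \<alpha> \<beta> x t (SOME p. ?P \<alpha> \<beta> x t p)" by (rule someI)
    then have "(SOME p. ?P \<alpha> \<beta> x t p) = (l, r)"
      using that by (auto intro!: prod_eqI dest: left_RL_deriv_unique right_RL_deriv_unique)
    then show ?thesis using * unfolding D_def by metis
  qed
  then have "op_of_form a b M D"
    unfolding op_of_form_def by (auto simp: D_def)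
  then show ?thesis by blast
qed

section \<open>The mapping on pairs of derivatives\<close>

definition derivative_mapping :: "real \<times> real \<Rightarrow> complex" where
  "derivative_mapping p = Complex ((fst p - snd p) / 2) ((fst p + snd p) / 2)"

lemma derivative_mapping_eq:
  "derivative_mapping (l, r)
     = 1 / 2 * (of_real l - of_real r) + \<i> / 2 * (of_real l + of_real r)"
  by (simp add: derivative_mapping_def complex_eq_iff)

lemma linear_derivative_mapping: "linear derivative_mapping"
  by (rule linearI) (auto simp: derivative_mapping_def complex_eq_iff field_simps)

lemma bij_derivative_mapping: "bij derivative_mapping"
  by (rule bij_betw_byWitness[where f' = "\<lambda>z. (Re z + Im z, Im z - Re z)"])
     (auto simp: derivative_mapping_def complex_eq_iff field_simps)

lemma linear_mapping_eqI:
  fixes M N :: "real \<times> real \<Rightarrow> complex"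
  assumes "linear M" "linear N" "M (1, - 1) = N (1, - 1)" "M (1, 1) = N (1, 1)"
  shows "M = N"
proof
  fix p :: "real \<times> real"
  let ?u = "(fst p - snd p) / 2" and ?v = "(fst p + snd p) / 2"
  have p: "p = ?u *\<^sub>R (1, - 1) + ?v *\<^sub>R (1, 1)"
    by (auto simp: prod_eq_iff field_simps)
  have "M (?u *\<^sub>R (1, - 1) + ?v *\<^sub>R (1, 1)) = N (?u *\<^sub>R (1, - 1) + ?v *\<^sub>R (1, 1))"
    using assms by (simp only: linear_add linear_scale)
  then show "M p = N p" using p by metis
qed

section \<open>Admissible operators\<close>

lemma derivative_mapping_admissible:
  assumes "op_of_form a b derivative_mapping D"
  shows "admissible_op a b D"
proof -
  note D = op_of_form_apply[OF assms]
  have "gluing a b D"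
    unfolding gluing_def
  proof (intro allI impI ballI)
    fix m :: nat and x t
    assume "1 \<le> m" "C_class_on m x {a<..<b}" "t \<in> {a<..<b}"
    then have "D (real m) (real m) x t = derivative_mapping ((deriv ^^ m) x t, - (deriv ^^ m) x t)"
      by (intro D left_integer right_integer)
    then show "D (real m) (real m) x t = of_real ((deriv ^^ m) x t)"
      by (simp add: derivative_mapping_def complex_eq_iff)
  qed
  moreover have "antisymmetric_condition a b D"
    unfolding antisymmetric_condition_def
  proof (intro allI impI ballI, elim conjE)
    fix x t dp dm
    assume x: "t \<in> {a<..<b}" "continuous_on {a<..<b} x"
      "(x has_real_derivative dp) (at_right t)" "(x has_real_derivative dm) (at_left t)"
      and "dp = - dm"
    have "D 1 1 x t = derivative_mapping (dp, - dm)"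
      using left_one[OF x] right_one[OF x] by (rule D)
    then show "D 1 1 x t = \<i> * of_real dp"
      using \<open>dp = - dm\<close> by (simp add: derivative_mapping_def complex_eq_iff)
  qed
  ultimately show ?thesis
    using assms linear_derivative_mapping bij_derivative_mapping
    unfolding admissible_op_def by blast
qed

lemma C_class_on_1_ident: "C_class_on 1 (\<lambda>s. s) S"
proof -
  have "deriv (\<lambda>s. s) = (\<lambda>s. 1 :: real)" by (simp add: fun_eq_iff)
  then show ?thesis
    by (auto simp: C_class_on_def le_Suc_eq)
qed

lemma abs_diff_has_one_sided_derivatives:
  fixes t :: real
  shows "((\<lambda>s. \<bar>s - t\<bar>) has_real_derivative 1) (at_right t)"
    and "((\<lambda>s. \<bar>s - t\<bar>) has_real_derivative - 1) (at_left t)"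
proof -
  have "((\<lambda>s. s - t) has_real_derivative 1) (at t within {t..})"
    by (auto intro!: derivative_eq_intros)
  then have "((\<lambda>s. \<bar>s - t\<bar>) has_real_derivative 1) (at t within {t..})"
    by (rule has_field_derivative_transform_within[where d = 1]) auto
  then show "((\<lambda>s. \<bar>s - t\<bar>) has_real_derivative 1) (at_right t)"
    by (rule has_field_derivative_subset) auto
  have "((\<lambda>s. t - s) has_real_derivative - 1) (at t within {..t})"
    by (auto intro!: derivative_eq_intros)
  then have "((\<lambda>s. \<bar>s - t\<bar>) has_real_derivative - 1) (at t within {..t})"
    by (rule has_field_derivative_transform_within[where d = 1]) auto
  then show "((\<lambda>s. \<bar>s - t\<bar>) has_real_derivative - 1) (at_left t)"
    by (rule has_field_derivative_subset) auto
qed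

text \<open>
  The two test functions need a point of \<open>(a, b)\<close>, so this is where the interval has to be
  nonempty.
\<close>

lemma admissible_mapping_eq:
  assumes "a < b" "op_of_form a b M D" "gluing a b D" "linear M" "antisymmetric_condition a b D"
  shows "M = derivative_mapping"
proof (rule linear_mapping_eqI[OF \<open>linear M\<close> linear_derivative_mapping])
  define t where "t = (a + b) / 2"
  have t: "t \<in> {a<..<b}" using \<open>a < b\<close> by (simp add: t_def)
  note D = op_of_form_apply[OF assms(2)]
  let ?x = "\<lambda>s :: real. s"
  have "D (real 1) (real 1) ?x t = M (1, - 1)"
    using D[OF left_integer[of 1 t a b ?x] right_integer[of 1 t a b ?x]] t C_class_on_1_ident
    by simp
  moreover have "D (real 1) (real 1) ?x t = of_real ((deriv ^^ 1) ?x t)"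
    using \<open>gluing a b D\<close> C_class_on_1_ident t unfolding gluing_def by blast
  ultimately show "M (1, - 1) = derivative_mapping (1, - 1)"
    by (simp add: derivative_mapping_def complex_eq_iff)
  let ?y = "\<lambda>s. \<bar>s - t\<bar>"
  have y: "continuous_on {a<..<b} ?y" by (intro continuous_intros)
  note dy = abs_diff_has_one_sided_derivatives[of t]
  have "D 1 1 ?y t = M (1, 1)"
    using D[OF left_one[OF t y dy] right_one[OF t y dy]] by simp
  moreover have "D 1 1 ?y t = \<i> * of_real 1"
    using \<open>antisymmetric_condition a b D\<close>[unfolded antisymmetric_condition_def,
      rule_format, of t ?y 1 "- 1"] t y dy by simp
  ultimately show "M (1, 1) = derivative_mapping (1, 1)"
    by (simp add: derivative_mapping_def complex_eq_iff)
qed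

lemma admissible_op_iff:
  assumes "a < b"
  shows "admissible_op a b D \<longleftrightarrow> op_of_form a b derivative_mapping D"
  using admissible_mapping_eq[OF assms] derivative_mapping_admissible
  unfolding admissible_op_def by blast

theorem lemma1p3:
  fixes a b :: real
  assumes "a < b"
  shows "(\<exists>!D. admissible_op a b D) \<and>
    (\<forall>D. admissible_op a b D \<longrightarrow>
      (\<forall>\<alpha> \<beta> x t l r. left_RL_deriv a b \<alpha> x t l \<longrightarrow> right_RL_deriv a b \<beta> x t r \<longrightarrow>
        D \<alpha> \<beta> x t = 1 / 2 * (of_real l - of_real r) + \<i> / 2 * (of_real l + of_real r)))"
proof
  show "\<exists>!D. admissible_op a b D"
    unfolding admissible_op_iff[OF assms] using op_of_form_exists op_of_form_unique by blast
  show "\<forall>D. admissible_op a b D \<longrightarrow>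
      (\<forall>\<alpha> \<beta> x t l r. left_RL_deriv a b \<alpha> x t l \<longrightarrow> right_RL_deriv a b \<beta> x t r \<longrightarrow>
        D \<alpha> \<beta> x t = 1 / 2 * (of_real l - of_real r) + \<i> / 2 * (of_real l + of_real r))"
  proof (rule allI, rule impI)
    \<comment> \<open>\<open>D\<close> is fixed before its arguments: generalised together with them, the term
      \<open>D \<alpha> \<beta> x t\<close> would be headed by a variable and match anything.\<close>
    fix D
    assume "admissible_op a b D"
    then have "op_of_form a b derivative_mapping D"
      by (simp only: admissible_op_iff[OF assms])
    note D = op_of_form_apply[OF this]
    show "\<forall>\<alpha> \<beta> x t l r. left_RL_deriv a b \<alpha> x t l \<longrightarrow> right_RL_deriv a b \<beta> x t r \<longrightarrow>
        D \<alpha> \<beta> x t = 1 / 2 * (of_real l - of_real r) + \<i> / 2 * (of_real l + of_real r)"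
      by (intro allI impI) (simp only: D derivative_mapping_eq)
  qed
qed

end
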